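(* Let $L\subseteq\Sigma^*$ be a regular language. The map $$\alpha:=\lambda[\![U]\!]_{\mathcal S_L^\vee}.\ \lambda X.\,U^{-1}X\ :\ \mathbf{Syn}_\vee(L)\to\mathbf{TS}(\mathfrak{dfa}(L))$$ is a well-defined isomorphism of idempotent semirings. It also defines a $\mathsf{JSL}$-dfa isomorphism $\mathfrak{syn}(L)\to\mathfrak{ts}(\mathfrak{dfa}(L))$.
   Context: Fix an alphabet $\Sigma$. $U^{-1}X=\{w:\exists u\in U.\,uw\in X\}$; $\mathsf{LQ}(L)=\{U^{-1}L:U\subseteq\Sigma^*\}$ (finite); $\overline L=\Sigma^*\setminus L$. A $\mathsf{JSL}$-dfa is $(s_0,\mathbb S,\delta_a,F)$ with $\mathbb S$ a finite join-semilattice (with bottom), $s_0\in S$, $\delta_a$ ($a\in\Sigma$) endomorphisms preserving all finite joins, and $F=\{s:s\nleq t\}$ for some $t\in S$. Morphisms are join-preserving functions (including bottom) preserving the initial state, commuting with transitions, and preserving and reflecting final states. $\mathfrak{dfa}(L)=(L,(\mathsf{LQ}(L),\cup,\emptyset),\lambda X.a^{-1}X,\{X:\varepsilon\in X\})$. Syntactic semiring. $\mathcal P_f\Sigma^*$, the finite languages with union, $\emptyset$, concatenation and $\{\varepsilon\}$, is the free $\Sigma$-generated idempotent semiring. The congruence $\mathcal S_L^\vee$ on it is: $\mathcal S_L^\vee(U,V)$ iff for all $x,y\in\Sigma^*$, $\{x\}U\{y\}\subseteq\overline L\iff\{x\}V\{y\}\subseteq\overline L$. $\mathbf{Syn}_\vee(L):=\mathcal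 P_f\Sigma^*/\mathcal S_L^\vee$, with classes $[\![U]\!]_{\mathcal S_L^\vee}$. Its associated $\mathsf{JSL}$-dfa $\mathfrak{syn}(L)$ has the additive semilattice of $\mathbf{Syn}_\vee(L)$ as states, initial state $[\![\{\varepsilon\}]\!]$, transitions $x\mapsto x\cdot[\![\{a\}]\!]$, final states $\{[\![U]\!]:U\cap L\neq\emptyset\}$. Transition semiring. For a $\mathsf{JSL}$-dfa $\gamma=(s_0,\mathbb S,\gamma_a,F)$ let $\gamma_\varepsilon=\mathrm{id}$, $\gamma_{wa}=\gamma_a\circ\gamma_w$, and for $K\subseteq\Sigma^*$ let $\gamma_K=\lambda s.\bigvee_{\mathbb S}\{\gamma_w(s):w\in K\}$. $\mathbf{TS}(\gamma)$ is the idempotent semiring with elements $\{\gamma_K:K\subseteq\Sigma^*\}$, addition the pointwise join ($\gamma_U\vee\gamma_V=\gamma_{U\cup V}$, zero $\gamma_\emptyset$), unit $\mathrm{id}$, and multiplication composition in diagrammatic order: $\gamma_U\cdot\gamma_V:=\gamma_V\circ\gamma_U=\gamma_{UV}$. Its associated $\mathsf{JSL}$-dfa is $\mathfrak{ts}(\gamma)=(\mathrm{id},\{\gamma_K\},\lambda f.\gamma_a\circ f,\{f:f\nleq\gamma_{\overline{L(\gamma)}}\})$, where $\leq$ is the pointwise order and $L(\gamma)$ is the language accepted by $\gamma$. For $\gamma=\mathfrak{dfa}(L)$ one has $\gamma_K=\lambda X.K^{-1}X$. *)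

theory Defs
  imports "HOL-Algebra.Ring"
begin

section \<open>Languages\<close>

text \<open>The alphabet is the type \<open>'a\<close>, words are lists, and \<open>- L\<close> is the complement of \<open>L\<close>.\<close>

type_synonym 'a lang = "'a list set"

definition conc :: "'a lang \<Rightarrow> 'a lang \<Rightarrow> 'a lang" where
  "conc U V = {u @ v |u v. u \<in> U \<and> v \<in> V}"

definition lquot :: "'a lang \<Rightarrow> 'a lang \<Rightarrow> 'a lang" where
  "lquot U X = {w. \<exists>u\<in>U. u @ w \<in> X}"

definition LQ :: "'a lang \<Rightarrow> 'a lang set" where
  "LQ L = range (\<lambda>U. lquot U L)"

text \<open>Acceptance by a finite deterministic automaton; taking the states from \<open>nat\<close> loses no
  generality.\<close>

definition regular :: "'a lang \<Rightarrow> bool" where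
  "regular L \<longleftrightarrow> (\<exists>(Q :: nat set) q\<^sub>0 \<delta> F. finite Q \<and> q\<^sub>0 \<in> Q \<and>
     (\<forall>a. \<forall>q\<in>Q. \<delta> a q \<in> Q) \<and> F \<subseteq> Q \<and> L = {w. fold \<delta> w q\<^sub>0 \<in> F})"


section \<open>Finite join-semilattices with bottom\<close>

text \<open>A join-semilattice with bottom is an idempotent commutative monoid: the monoid operation
  \<open>\<otimes>\<close> is the binary join, the unit \<open>\<one>\<close> is the bottom element and
  \<^const>\<open>finprod\<close> computes finite joins.\<close>

definition fin_jsl :: "'s monoid \<Rightarrow> bool" where
  "fin_jsl S \<longleftrightarrow> comm_monoid S \<and> (\<forall>s\<in>carrier S. s \<otimes>\<^bsub>S\<^esub> s = s) \<and> finite (carrier S)"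

definition jsl_le :: "'s monoid \<Rightarrow> 's \<Rightarrow> 's \<Rightarrow> bool" where
  "jsl_le S s t \<longleftrightarrow> s \<otimes>\<^bsub>S\<^esub> t = t"

definition jsl_join :: "'s monoid \<Rightarrow> 's set \<Rightarrow> 's" where
  "jsl_join S A = (\<Otimes>\<^bsub>S\<^esub>s\<in>A. s)"

definition jsl_hom :: "'s monoid \<Rightarrow> 't monoid \<Rightarrow> ('s \<Rightarrow> 't) set" where
  "jsl_hom S T = {h. h \<in> hom S T \<and> h \<one>\<^bsub>S\<^esub> = \<one>\<^bsub>T\<^esub>}"


section \<open>JSL-dfas\<close>

record ('a, 's) jsl_dfa =
  init :: 's
  states :: "'s monoid"
  step :: "'a \<Rightarrow> 's \<Rightarrow> 's"
  final :: "'s set"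

definition is_jsl_dfa :: "('a, 's) jsl_dfa \<Rightarrow> bool" where
  "is_jsl_dfa \<gamma> \<longleftrightarrow>
     fin_jsl (states \<gamma>) \<and>
     init \<gamma> \<in> carrier (states \<gamma>) \<and>
     (\<forall>a. step \<gamma> a \<in> jsl_hom (states \<gamma>) (states \<gamma>)) \<and>
     (\<exists>t\<in>carrier (states \<gamma>). final \<gamma> = {s \<in> carrier (states \<gamma>). \<not> jsl_le (states \<gamma>) s t})"

definition jsl_dfa_hom :: "('a, 's) jsl_dfa \<Rightarrow> ('a, 't) jsl_dfa \<Rightarrow> ('s \<Rightarrow> 't) set" where
  "jsl_dfa_hom \<gamma> \<delta> = {h.
     h \<in> jsl_hom (states \<gamma>) (states \<delta>) \<and>
     h (init \<gamma>) = init \<delta> \<and>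
     (\<forall>a. \<forall>s\<in>carrier (states \<gamma>). h (step \<gamma> a s) = step \<delta> a (h s)) \<and>
     (\<forall>s\<in>carrier (states \<gamma>). h s \<in> final \<delta> \<longleftrightarrow> s \<in> final \<gamma>)}"

definition jsl_dfa_iso :: "('a, 's) jsl_dfa \<Rightarrow> ('a, 't) jsl_dfa \<Rightarrow> ('s \<Rightarrow> 't) set" where
  "jsl_dfa_iso \<gamma> \<delta> = {h.
     is_jsl_dfa \<gamma> \<and> is_jsl_dfa \<delta> \<and> h \<in> jsl_dfa_hom \<gamma> \<delta> \<and>
     (\<exists>g\<in>jsl_dfa_hom \<delta> \<gamma>.
        (\<forall>s\<in>carrier (states \<gamma>). g (h s) = s) \<and> (\<forall>t\<in>carrier (states \<delta>). h (g t) = t))}"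

definition word_trans :: "('a, 's) jsl_dfa \<Rightarrow> 'a list \<Rightarrow> 's \<Rightarrow> 's" where
  "word_trans \<gamma> w = fold (step \<gamma>) w"

definition lang_trans :: "('a, 's) jsl_dfa \<Rightarrow> 'a lang \<Rightarrow> 's \<Rightarrow> 's" where
  "lang_trans \<gamma> K =
     (\<lambda>s\<in>carrier (states \<gamma>). jsl_join (states \<gamma>) ((\<lambda>w. word_trans \<gamma> w s) ` K))"

definition language :: "('a, 's) jsl_dfa \<Rightarrow> 'a lang" where
  "language \<gamma> = {w. word_trans \<gamma> w (init \<gamma>) \<in> final \<gamma>}"

definition dfa :: "'a lang \<Rightarrow> ('a, 'a lang) jsl_dfa" where
  "dfa L = \<lparr>
     init = L,
     states = \<lparr>carrier = LQ L, mult = (\<union>), one = {}\<rparr>,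
     step = (\<lambda>a X. lquot {[a]} X),
     final = {X \<in> LQ L. [] \<in> X}\<rparr>"


section \<open>Idempotent semirings\<close>

definition idem_semiring :: "'r ring \<Rightarrow> bool" where
  "idem_semiring R \<longleftrightarrow> semiring R \<and> (\<forall>x\<in>carrier R. x \<oplus>\<^bsub>R\<^esub> x = x)"

text \<open>Preservation of \<open>\<zero>\<close> is not part of \<^const>\<open>ring_hom\<close>.\<close>

definition idem_semiring_iso :: "'r ring \<Rightarrow> 't ring \<Rightarrow> ('r \<Rightarrow> 't) set" where
  "idem_semiring_iso R S = {h.
     idem_semiring R \<and> idem_semiring S \<and>
     h \<in> ring_hom R S \<and> h \<zero>\<^bsub>R\<^esub> = \<zero>\<^bsub>S\<^esub> \<and> bij_betw h (carrier R) (carrier S)}"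


section \<open>The syntactic semiring\<close>

definition synt_cong :: "'a lang \<Rightarrow> ('a lang \<times> 'a lang) set" where
  "synt_cong L = {(U, V). finite U \<and> finite V \<and>
     (\<forall>x y. conc (conc {x} U) {y} \<subseteq> - L \<longleftrightarrow> conc (conc {x} V) {y} \<subseteq> - L)}"

definition synt_class :: "'a lang \<Rightarrow> 'a lang \<Rightarrow> 'a lang set" where
  "synt_class L U = synt_cong L `` {U}"

definition Syn :: "'a lang \<Rightarrow> 'a lang set ring" where
  "Syn L = \<lparr>
     carrier = {U. finite U} // synt_cong L,
     mult = (\<lambda>C D. \<Union>U\<in>C. \<Union>V\<in>D. synt_class L (conc U V)),
     one = synt_class L {[]},
     zero = synt_class L {},
     add = (\<lambda>C D. \<Union>U\<in>C. \<Union>V\<in>D. synt_class L (U \<union> V))\<rparr>"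

definition syn :: "'a lang \<Rightarrow> ('a, 'a lang set) jsl_dfa" where
  "syn L = \<lparr>
     init = synt_class L {[]},
     states = add_monoid (Syn L),
     step = (\<lambda>a C. C \<otimes>\<^bsub>Syn L\<^esub> synt_class L {[a]}),
     final = {synt_class L U |U. finite U \<and> U \<inter> L \<noteq> {}}\<rparr>"


section \<open>The transition semiring\<close>

text \<open>The elements are extensional functions on the carrier of the state semilattice;
  \<open>compose S g f\<close> is \<open>g \<circ> f\<close> restricted to \<open>S\<close>.\<close>

definition TS :: "('a, 's) jsl_dfa \<Rightarrow> ('s \<Rightarrow> 's) ring" where
  "TS \<gamma> = \<lparr>
     carrier = range (lang_trans \<gamma>),
     mult = (\<lambda>f g. compose (carrier (states \<gamma>)) g f),
     one = (\<lambda>s\<in>carrier (states \<gamma>). s),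
     zero = lang_trans \<gamma> {},
     add = (\<lambda>f g. \<lambda>s\<in>carrier (states \<gamma>). f s \<otimes>\<^bsub>states \<gamma>\<^esub> g s)\<rparr>"

definition ts :: "('a, 's) jsl_dfa \<Rightarrow> ('a, 's \<Rightarrow> 's) jsl_dfa" where
  "ts \<gamma> = \<lparr>
     init = (\<lambda>s\<in>carrier (states \<gamma>). s),
     states = add_monoid (TS \<gamma>),
     step = (\<lambda>a f. compose (carrier (states \<gamma>)) (step \<gamma> a) f),
     final = {f \<in> carrier (TS \<gamma>).
       \<not> (\<forall>s\<in>carrier (states \<gamma>).
            jsl_le (states \<gamma>) (f s) (lang_trans \<gamma> (- language \<gamma>) s))}\<rparr>"


section \<open>The map \<open>\<alpha>\<close>\<close>

definition lquot_fun :: "'a lang \<Rightarrow> 'a lang \<Rightarrow> 'a lang \<Rightarrow> 'a lang" where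
  "lquot_fun L U = (\<lambda>X\<in>LQ L. lquot U X)"

text \<open>\<^const>\<open>the_elem\<close> yields the common value of \<^const>\<open>lquot_fun\<close> on a congruence class;
  it is meaningful only if \<^const>\<open>lquot_fun\<close> respects the congruence.\<close>

definition alpha :: "'a lang \<Rightarrow> 'a lang set \<Rightarrow> 'a lang \<Rightarrow> 'a lang" where
  "alpha L = (\<lambda>C\<in>carrier (Syn L). the_elem (lquot_fun L ` C))"

end

theory Submission
  imports Defs
begin

text \<open>Write \<open>f U\<close> for the class of a finite language \<open>U\<close> and \<open>g U\<close> for \<open>\<lambda>X. lquot U X\<close>. Both \<open>f\<close>
  and \<open>g\<close> turn union and concatenation into the operations of the respective semiring, and they
  identify the same pairs: \<open>conc (conc {x} U) {y}\<close> meets \<open>L\<close> iff \<open>y \<in> lquot U (lquot {x} L)\<close>,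
  while \<open>lquot U\<close> on \<open>LQ L\<close> is determined by its values at the \<open>lquot {x} L\<close>. Hence \<open>f U \<mapsto> g U\<close> is
  an injective homomorphism. It is onto since \<open>LQ L\<close> is finite, so that the words of an arbitrary
  language \<open>K\<close> induce only finitely many functions on \<open>LQ L\<close> and \<open>K\<close> can be replaced by a finite
  subset.\<close>

section \<open>Languages and quotients\<close>

lemma mem_lquot: "w \<in> lquot U X \<longleftrightarrow> (\<exists>u\<in>U. u @ w \<in> X)"
  by (simp add: lquot_def)

lemma lquot_empty [simp]: "lquot {} X = {}"
  by (auto simp: lquot_def)

lemma lquot_Nil [simp]: "lquot {[]} X = X"
  by (auto simp: lquot_def)

lemma lquot_Un: "lquot (U \<union> V) X = lquot U X \<union> lquot V X"
  by (auto simp: lquot_def)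

text \<open>The prefix from \<open>U\<close> is removed first; this matches the product of
  \<open>TS\<close>, where the left factor acts first.\<close>

lemma lquot_conc: "lquot (conc U V) X = lquot V (lquot U X)"
  by (fastforce simp: lquot_def conc_def)

lemma lquot_mem_LQ [simp]: "lquot U L \<in> LQ L"
  by (simp add: LQ_def)

lemma lquot_LQ [simp]: "X \<in> LQ L \<Longrightarrow> lquot U X \<in> LQ L"
  by (auto simp: LQ_def lquot_conc [symmetric])

lemma self_mem_LQ [simp]: "L \<in> LQ L"
  by (metis lquot_Nil lquot_mem_LQ)

lemma empty_mem_LQ [simp]: "{} \<in> LQ L"
  by (metis lquot_empty lquot_mem_LQ)

lemma Un_mem_LQ [simp]: "X \<in> LQ L \<Longrightarrow> Y \<in> LQ L \<Longrightarrow> X \<union> Y \<in> LQ L"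
  by (auto simp: LQ_def lquot_Un [symmetric])

lemma finite_conc [simp]: "finite U \<Longrightarrow> finite V \<Longrightarrow> finite (conc U V)"
proof -
  have "conc U V = (\<lambda>(u, v). u @ v) ` (U \<times> V)"
    by (auto simp: conc_def)
  then show "finite U \<Longrightarrow> finite V \<Longrightarrow> finite (conc U V)"
    by simp
qed

lemma conc_assoc: "conc (conc U V) W = conc U (conc V W)"
proof -
  have "conc (conc U V) W = {u @ v @ w |u v w. u \<in> U \<and> v \<in> V \<and> w \<in> W}"
    by (simp add: conc_def set_eq_iff) (metis append_assoc)
  also have "\<dots> = conc U (conc V W)"
    unfolding conc_def by blast
  finally show ?thesis .
qed

lemma conc_Nil [simp]: "conc {[]} U = U" "conc U {[]} = U"
  by (auto simp: conc_def)

lemma conc_empty [simp]: "conc {} U = {}" "conc U {} = {}"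
  by (auto simp: conc_def)

lemma conc_Un: "conc (U \<union> V) W = conc U W \<union> conc V W" "conc W (U \<union> V) = conc W U \<union> conc W V"
  by (auto simp: conc_def)

text \<open>A quotient \<open>lquot U L\<close> depends only on the set of states reached from
  \<open>q0\<close> by words of \<open>U\<close>, and \<open>Q\<close> has finitely many
  subsets.\<close>

lemma finite_LQ:
  assumes "regular L"
  shows "finite (LQ L)"
proof -
  obtain Q :: "nat set" and q0 \<delta> F where Q: "finite Q" "q0 \<in> Q"
      "\<And>a q. q \<in> Q \<Longrightarrow> \<delta> a q \<in> Q" and L: "L = {w. fold \<delta> w q0 \<in> F}"
    using assms unfolding regular_def by metis
  have mem: "fold \<delta> w q \<in> Q" if "q \<in> Q" for w q
    using that by (induction w arbitrary: q) (auto simp: Q)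
  have "lquot U L \<in> (\<lambda>P. {w. \<exists>q\<in>P. fold \<delta> w q \<in> F}) ` Pow Q" for U
  proof (rule image_eqI)
    show "lquot U L = {w. \<exists>q\<in>(\<lambda>u. fold \<delta> u q0) ` U. fold \<delta> w q \<in> F}"
      by (auto simp: lquot_def L)
    show "(\<lambda>u. fold \<delta> u q0) ` U \<in> Pow Q"
      using mem [OF Q(2)] by blast
  qed
  then have "LQ L \<subseteq> (\<lambda>P. {w. \<exists>q\<in>P. fold \<delta> w q \<in> F}) ` Pow Q"
    unfolding LQ_def by (rule image_subsetI)
  then show ?thesis
    by (rule finite_subset) (simp add: Q)
qed


section \<open>Quotients of the free idempotent semiring\<close>

text \<open>Common interface of \<open>Syn L\<close> and \<open>TS (dfa L)\<close>: an image of the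
  semiring of finite languages. The semiring laws are not assumed of \<open>R\<close>; they transfer
  along \<open>f\<close>.\<close>

locale lang_semiring =
  fixes R :: "'r ring" and f :: "'a lang \<Rightarrow> 'r"
  assumes carrier: "carrier R = f ` {U. finite U}"
    and zero: "\<zero>\<^bsub>R\<^esub> = f {}"
    and one: "\<one>\<^bsub>R\<^esub> = f {[]}"
    and add: "\<And>U V. finite U \<Longrightarrow> finite V \<Longrightarrow> f U \<oplus>\<^bsub>R\<^esub> f V = f (U \<union> V)"
    and mult: "\<And>U V. finite U \<Longrightarrow> finite V \<Longrightarrow> f U \<otimes>\<^bsub>R\<^esub> f V = f (conc U V)"
begin

lemma idem_semiring: "idem_semiring R"
proof -
  have "abelian_monoid R"
    by (rule abelian_monoidI) (auto simp: carrier zero add Un_ac)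
  moreover have "monoid R"
    by (rule monoidI) (auto simp: carrier one mult conc_assoc)
  ultimately have "semiring R"
    by (intro semiring.intro semiring_axioms.intro)
      (auto simp: carrier zero add mult conc_Un)
  then show ?thesis
    by (auto simp: idem_semiring_def carrier add)
qed

lemma fin_jsl: "finite (carrier R) \<Longrightarrow> fin_jsl (add_monoid R)"
  using idem_semiring
  by (simp add: fin_jsl_def idem_semiring_def semiring_def abelian_monoid_def)

end

text \<open>Two images of the same semiring with the same kernel are isomorphic: \<open>eq\<close>
  from right to left gives injectivity of \<open>h\<close>.\<close>

lemma lang_semiring_iso:
  assumes R: "lang_semiring R f" and S: "lang_semiring S g"
    and eq: "\<And>U V. finite U \<Longrightarrow> finite V \<Longrightarrow> f U = f V \<longleftrightarrow> g U = g V"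
    and h: "\<And>U. finite U \<Longrightarrow> h (f U) = g U"
  shows "h \<in> idem_semiring_iso R S"
proof -
  interpret R: lang_semiring R f by (fact R)
  interpret S: lang_semiring S g by (fact S)
  have "h \<in> ring_hom R S"
    by (rule ring_hom_memI)
      (auto simp: R.carrier S.carrier R.one S.one R.add S.add R.mult S.mult h)
  moreover have "bij_betw h (carrier R) (carrier S)"
    by (force simp: bij_betw_def inj_on_def R.carrier S.carrier h eq)
  ultimately show ?thesis
    by (simp add: idem_semiring_iso_def R.idem_semiring S.idem_semiring R.zero S.zero h)
qed

text \<open>In the last assumption, \<open>f T\<close> is the largest non-final state.\<close>

locale lang_dfa = lang_semiring R f
  for R :: "'r ring" and f :: "'a lang \<Rightarrow> 'r" +
  fixes \<gamma> :: "('a, 'r) jsl_dfa" and L :: "'a lang"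
  assumes finite_carrier: "finite (carrier R)"
    and init: "init \<gamma> = f {[]}"
    and states: "states \<gamma> = add_monoid R"
    and step: "\<And>a U. finite U \<Longrightarrow> step \<gamma> a (f U) = f (conc U {[a]})"
    and final: "final \<gamma> = {f U |U. finite U \<and> U \<inter> L \<noteq> {}}"
    and top_nonfinal: "\<exists>T. finite T \<and> (\<forall>U. finite U \<longrightarrow> (f (U \<union> T) = f T \<longleftrightarrow> U \<inter> L = {}))"
begin

text \<open>Finality must not depend on the representative \<open>U\<close>. By
  \<open>top_nonfinal\<close>, meeting \<open>L\<close> is expressed through the sum of
  \<open>f U\<close> and \<open>f T\<close>, hence through \<open>f U\<close> alone.\<close>

lemma final_iff:
  assumes "finite U"
  shows "f U \<in> final \<gamma> \<longleftrightarrow> U \<inter> L \<noteq> {}"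
proof -
  obtain T where T: "finite T" "\<And>U. finite U \<Longrightarrow> f (U \<union> T) = f T \<longleftrightarrow> U \<inter> L = {}"
    using top_nonfinal by blast
  have "U \<inter> L \<noteq> {}" if "f U = f V" "finite V" "V \<inter> L \<noteq> {}" for V
    using that assms T by (metis add)
  then show ?thesis
    using assms by (auto simp: final)
qed

lemma is_jsl_dfa: "is_jsl_dfa \<gamma>"
proof -
  have "step \<gamma> a \<in> jsl_hom (states \<gamma>) (states \<gamma>)" for a
    by (auto simp: jsl_hom_def states intro!: homI)
      (auto simp: carrier zero step add conc_Un)
  moreover have "\<exists>t\<in>carrier (states \<gamma>).
      final \<gamma> = {s \<in> carrier (states \<gamma>). \<not> jsl_le (states \<gamma>) s t}"
  proof -
    obtain T where T: "finite T" "\<And>U. finite U \<Longrightarrow> f (U \<union> T) = f T \<longleftrightarrow> U \<inter> L = {}"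
      using top_nonfinal by blast
    have "final \<gamma> = {f U |U. finite U \<and> f (U \<union> T) \<noteq> f T}"
      unfolding final using T(2) by blast
    also have "\<dots> = {f U |U. finite U \<and> f U \<oplus>\<^bsub>R\<^esub> f T \<noteq> f T}"
      using add T(1) by metis
    also have "\<dots> = {s \<in> carrier (states \<gamma>). \<not> jsl_le (states \<gamma>) s (f T)}"
      by (auto simp: states carrier jsl_le_def)
    finally show ?thesis
      using T by (auto simp: states carrier)
  qed
  ultimately show ?thesis
    using fin_jsl [OF finite_carrier] by (simp add: is_jsl_dfa_def states init carrier)
qed

end

lemma lang_dfa_hom:
  assumes R: "lang_dfa R f \<gamma> L" and S: "lang_dfa S g \<delta> L"
    and h: "\<And>U. finite U \<Longrightarrow> h (f U) = g U"
  shows "h \<in> jsl_dfa_hom \<gamma> \<delta>"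
proof -
  interpret R: lang_dfa R f \<gamma> L by (fact R)
  interpret S: lang_dfa S g \<delta> L by (fact S)
  have "h \<in> jsl_hom (states \<gamma>) (states \<delta>)"
    by (auto simp: jsl_hom_def R.states S.states intro!: homI)
      (auto simp: R.carrier S.carrier R.zero S.zero R.add S.add h)
  then show ?thesis
    by (auto simp: jsl_dfa_hom_def R.states R.carrier R.init S.init R.step S.step
        R.final_iff S.final_iff h)
qed

lemma lang_dfa_iso:
  assumes R: "lang_dfa R f \<gamma> L" and S: "lang_dfa S g \<delta> L"
    and eq: "\<And>U V. finite U \<Longrightarrow> finite V \<Longrightarrow> f U = f V \<longleftrightarrow> g U = g V"
    and h: "\<And>U. finite U \<Longrightarrow> h (f U) = g U"
  shows "h \<in> jsl_dfa_iso \<gamma> \<delta>"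
proof -
  interpret R: lang_dfa R f \<gamma> L by (fact R)
  interpret S: lang_dfa S g \<delta> L by (fact S)
  have "inj_on h (carrier R)"
    by (auto simp: inj_on_def R.carrier h eq)
  \<comment> \<open>The inverse satisfies the hypothesis on \<open>h\<close> with \<open>f\<close>
    and \<open>g\<close> exchanged, so \<open>lang_dfa_hom\<close> also covers it.\<close>
  then have k: "inv_into (carrier R) h (g U) = f U" if "finite U" for U
    using that by (intro inv_into_f_eq) (auto simp: R.carrier h)
  show ?thesis
    unfolding jsl_dfa_iso_def
  proof (intro CollectI conjI bexI)
    show "inv_into (carrier R) h \<in> jsl_dfa_hom \<delta> \<gamma>"
      using S R k by (rule lang_dfa_hom)
  qed (auto simp: R.is_jsl_dfa S.is_jsl_dfa R.states S.states R.carrier S.carrier h k [unfolded R.carrier]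
      intro: lang_dfa_hom [OF R S h])
qed


section \<open>The syntactic semiring\<close>

lemma lquot_fun_eq_iff:
  "lquot_fun L U = lquot_fun L V \<longleftrightarrow> (\<forall>x. lquot U (lquot {x} L) = lquot V (lquot {x} L))"
proof
  assume "lquot_fun L U = lquot_fun L V"
  then show "\<forall>x. lquot U (lquot {x} L) = lquot V (lquot {x} L)"
    by (metis lquot_fun_def lquot_mem_LQ restrict_apply')
next
  \<comment> \<open>Every element of \<open>LQ L\<close> is a union of quotients by single words,
    and \<open>lquot U\<close> distributes over unions.\<close>
  have UN: "lquot U (lquot W L) = (\<Union>x\<in>W. lquot U (lquot {x} L))" for U W
    by (auto simp: lquot_def)
  assume "\<forall>x. lquot U (lquot {x} L) = lquot V (lquot {x} L)"
  then have "lquot U (lquot W L) = lquot V (lquot W L)" for W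
    by (subst (1 2) UN) simp
  then show "lquot_fun L U = lquot_fun L V"
    by (auto simp: lquot_fun_def LQ_def intro!: restrict_ext)
qed

lemma conc_subset_Compl_iff: "conc (conc {x} U) {y} \<subseteq> - L \<longleftrightarrow> y \<notin> lquot U (lquot {x} L)"
proof -
  have "conc (conc {x} U) {y} = {x @ u @ y |u. u \<in> U}"
    by (fastforce simp: conc_def)
  then show ?thesis
    by (auto simp: lquot_def)
qed

text \<open>The syntactic congruence is the kernel of \<open>lquot_fun L\<close> on finite
  languages; both well-definedness and injectivity of \<open>alpha\<close> rest on this.\<close>

lemma synt_cong_iff:
  "(U, V) \<in> synt_cong L \<longleftrightarrow> finite U \<and> finite V \<and> lquot_fun L U = lquot_fun L V"
  by (auto simp: synt_cong_def conc_subset_Compl_iff lquot_fun_eq_iff)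

lemma synt_class_altdef:
  "finite U \<Longrightarrow> synt_class L U = {V. finite V \<and> lquot_fun L V = lquot_fun L U}"
  by (auto simp: synt_class_def synt_cong_iff)

lemma synt_class_eq_iff:
  "finite U \<Longrightarrow> finite V \<Longrightarrow> synt_class L U = synt_class L V \<longleftrightarrow> lquot_fun L U = lquot_fun L V"
  by (auto simp: synt_class_altdef)

lemma lquot_fun_Un:
  "lquot_fun L (U \<union> V) = (\<lambda>X\<in>LQ L. lquot_fun L U X \<union> lquot_fun L V X)"
  by (auto simp: lquot_fun_def lquot_Un intro!: restrict_ext)

lemma lquot_fun_conc:
  "lquot_fun L (conc U V) = compose (LQ L) (lquot_fun L V) (lquot_fun L U)"
  by (auto simp: lquot_fun_def lquot_conc compose_def intro!: restrict_ext)

text \<open>The operations of \<open>Syn\<close> are unions over all representatives. As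
  \<open>q\<close> computes the function of \<open>p U' V'\<close> from those of \<open>U'\<close>
  and \<open>V'\<close>, all sets in the union coincide.\<close>

lemma UN_synt_class:
  assumes "finite U" "finite V"
    and "\<And>U' V'. finite U' \<Longrightarrow> finite V' \<Longrightarrow> finite (p U' V')"
    and "\<And>U' V'. lquot_fun L (p U' V') = q (lquot_fun L U') (lquot_fun L V')"
  shows "(\<Union>U'\<in>synt_class L U. \<Union>V'\<in>synt_class L V. synt_class L (p U' V')) = synt_class L (p U V)"
  using assms by (fastforce simp: synt_class_altdef)

lemma lang_semiring_Syn: "lang_semiring (Syn L) (synt_class L)"
proof
  fix U V :: "'a lang"
  assume UV: "finite U" "finite V"
  show "synt_class L U \<oplus>\<^bsub>Syn L\<^esub> synt_class L V = synt_class L (U \<union> V)"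
    unfolding Syn_def ring.simps
    by (rule UN_synt_class [OF UV, where q = "\<lambda>F G. \<lambda>X\<in>LQ L. F X \<union> G X"])
      (simp_all add: lquot_fun_Un)
  show "synt_class L U \<otimes>\<^bsub>Syn L\<^esub> synt_class L V = synt_class L (conc U V)"
    unfolding Syn_def monoid.simps
    by (rule UN_synt_class [OF UV, where q = "\<lambda>F G. compose (LQ L) G F"])
      (simp_all add: lquot_fun_conc)
qed (auto simp: Syn_def quotient_def synt_class_def)

lemma alpha_synt_class: "finite U \<Longrightarrow> alpha L (synt_class L U) = lquot_fun L U"
proof -
  assume U: "finite U"
  then have "synt_class L U \<in> carrier (Syn L)"
    by (simp add: lang_semiring.carrier [OF lang_semiring_Syn])
  moreover have "lquot_fun L ` synt_class L U = {lquot_fun L U}"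
    using U by (auto simp: synt_class_altdef)
  ultimately show ?thesis
    by (simp add: alpha_def)
qed


section \<open>The transition semiring\<close>

lemma states_dfa [simp]: "states (dfa L) = \<lparr>carrier = LQ L, mult = (\<union>), one = {}\<rparr>"
  by (simp add: dfa_def)

lemma step_dfa [simp]: "step (dfa L) = (\<lambda>a. lquot {[a]})"
  by (simp add: dfa_def)

lemma jsl_join_LQ:
  assumes "finite A" "A \<subseteq> LQ L"
  shows "jsl_join (states (dfa L)) A = \<Union>A"
proof -
  interpret comm_monoid "states (dfa L)"
    by (rule comm_monoidI) auto
  show ?thesis
    using assms unfolding jsl_join_def
  proof (induction A)
    case empty
    show ?case
      \<comment> \<open>The first \<open>simp\<close> keeps \<open>states (dfa L)\<close> folded so
        that the interpreted \<open>finprod\<close> rules match; the second unfolds the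
        monoid.\<close>
      by (simp del: states_dfa) simp
  next
    case (insert X A)
    then have "(\<lambda>s. s) \<in> A \<rightarrow> carrier (states (dfa L))" "X \<in> carrier (states (dfa L))"
      by auto
    with insert show ?case
      by (simp del: states_dfa) simp
  qed
qed

lemma word_trans_dfa: "word_trans (dfa L) w X = lquot {w} X"
  by (induction w arbitrary: X) (auto simp: word_trans_def lquot_def)

lemma language_dfa: "language (dfa L) = L"
proof -
  have "language (dfa L) = {w. [] \<in> lquot {w} L}"
    by (simp add: language_def word_trans_dfa) (simp add: dfa_def)
  then show ?thesis
    by (simp add: lquot_def)
qed

text \<open>For infinite \<open>K\<close> the join is still over a finite subset of
  \<open>LQ L\<close>; \<open>finprod\<close> over an infinite set would merely return the
  unit.\<close>

lemma lang_trans_dfa: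
  assumes "finite (LQ L)"
  shows "lang_trans (dfa L) K = lquot_fun L K"
proof -
  have "jsl_join (states (dfa L)) ((\<lambda>w. word_trans (dfa L) w X) ` K) = lquot K X" if "X \<in> LQ L" for X
  proof -
    have "(\<lambda>w. word_trans (dfa L) w X) ` K \<subseteq> LQ L"
      using that by (auto simp: word_trans_dfa)
    then show ?thesis
      using assms by (subst jsl_join_LQ) (auto simp: word_trans_dfa lquot_def intro: finite_subset)
  qed
  then show ?thesis
    by (auto simp: lang_trans_def lquot_fun_def intro!: restrict_ext)
qed

lemma finite_lquot_funs:
  assumes "finite (LQ L)"
  shows "finite (range (lquot_fun L))"
proof (rule finite_subset)
  show "range (lquot_fun L) \<subseteq> LQ L \<rightarrow>\<^sub>E LQ L"
    by (auto simp: lquot_fun_def)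
  show "finite (LQ L \<rightarrow>\<^sub>E LQ L)"
    using assms by (simp add: finite_PiE)
qed

lemma lquot_fun_finite_language:
  assumes "finite (LQ L)"
  shows "\<exists>U. finite U \<and> lquot_fun L U = lquot_fun L K"
proof -
  have "finite ((\<lambda>w. lquot_fun L {w}) ` K)"
    using finite_lquot_funs [OF assms] by (rule finite_subset [rotated]) auto
  then obtain U where U: "finite U" "U \<subseteq> K"
      "(\<lambda>w. lquot_fun L {w}) ` K = (\<lambda>w. lquot_fun L {w}) ` U"
    by (meson finite_subset_image subset_refl)
  \<comment> \<open>The right-hand side depends on \<open>V\<close> only through the set of
    functions induced by its words, which is the same for \<open>U\<close> and
    \<open>K\<close>.\<close>
  have "lquot_fun L V = (\<lambda>X\<in>LQ L. \<Union>F\<in>(\<lambda>w. lquot_fun L {w}) ` V. F X)" for V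
    by (auto simp: lquot_fun_def lquot_def intro!: restrict_ext)
  then have "lquot_fun L U = lquot_fun L K"
    using U(3) by metis
  with U(1) show ?thesis
    by blast
qed

lemma carrier_TS:
  assumes "finite (LQ L)"
  shows "carrier (TS (dfa L)) = lquot_fun L ` {U. finite U}"
proof -
  have "lquot_fun L K \<in> lquot_fun L ` {U. finite U}" for K
    using lquot_fun_finite_language [OF assms, of K] by (metis imageI mem_Collect_eq)
  then show ?thesis
    by (auto simp: TS_def lang_trans_dfa [OF assms])
qed

lemma lang_semiring_TS:
  assumes "finite (LQ L)"
  shows "lang_semiring (TS (dfa L)) (lquot_fun L)"
proof
  show "\<one>\<^bsub>TS (dfa L)\<^esub> = lquot_fun L {[]}"
    by (simp add: TS_def lquot_fun_def)
qed (simp_all add: carrier_TS assms,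
    simp_all add: TS_def lang_trans_dfa assms lquot_fun_Un lquot_fun_conc)


section \<open>The associated automata\<close>

text \<open>\<open>T\<close> stands for a finite substitute of \<open>- L\<close>. Evaluating at the
  state \<open>L\<close> and the word \<open>[]\<close> detects whether a language meets
  \<open>L\<close>, and \<open>- L\<close> does not.\<close>

lemma lquot_fun_nonfinal_iff:
  assumes "lquot_fun L T = lquot_fun L (- L)"
  shows "lquot_fun L (U \<union> T) = lquot_fun L T \<longleftrightarrow> U \<inter> L = {}"
proof -
  have "lquot_fun L (U \<union> T) = lquot_fun L (U \<union> - L)"
    by (simp add: lquot_fun_Un assms)
  moreover have "U \<inter> L = {}" if "lquot_fun L (U \<union> - L) = lquot_fun L (- L)"
  proof -
    have "lquot (U \<union> - L) L = lquot (- L) L"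
      using fun_cong [OF that, of L] by (simp add: lquot_fun_def)
    then have "[] \<in> lquot U L \<Longrightarrow> [] \<in> lquot (- L) L"
      by (auto simp: lquot_Un)
    then show ?thesis
      by (auto simp: mem_lquot)
  qed
  moreover have "U \<union> - L = - L" if "U \<inter> L = {}"
    using that by blast
  ultimately show ?thesis
    using assms by auto
qed

lemma lang_dfa_ts:
  assumes fin: "finite (LQ L)"
  shows "lang_dfa (TS (dfa L)) (lquot_fun L) (ts (dfa L)) L"
proof (rule lang_dfa.intro [OF lang_semiring_TS [OF fin]], unfold_locales)
  show "finite (carrier (TS (dfa L)))"
    using finite_lquot_funs [OF fin] by (simp add: TS_def lang_trans_dfa [OF fin])
  show "init (ts (dfa L)) = lquot_fun L {[]}"
    by (simp add: ts_def lquot_fun_def)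
  show "states (ts (dfa L)) = add_monoid (TS (dfa L))"
    by (simp add: ts_def)
  show "step (ts (dfa L)) a (lquot_fun L U) = lquot_fun L (conc U {[a]})" for a U
    by (auto simp: ts_def lquot_fun_def lquot_conc compose_def intro!: restrict_ext)
  show "\<exists>T. finite T \<and> (\<forall>U. finite U \<longrightarrow>
      (lquot_fun L (U \<union> T) = lquot_fun L T \<longleftrightarrow> U \<inter> L = {}))"
    using lquot_fun_finite_language [OF fin] lquot_fun_nonfinal_iff by metis
  \<comment> \<open>Pointwise inclusion is turned into absorption by the function of
    \<open>- L\<close>, so that the preceding lemma applies with \<open>- L\<close> for
    \<open>T\<close>.\<close>
  have le_iff: "(\<forall>X\<in>LQ L. lquot_fun L U X \<subseteq> lquot_fun L (- L) X) \<longleftrightarrow> U \<inter> L = {}" for U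
    unfolding lquot_fun_nonfinal_iff [OF refl, symmetric]
    by (auto simp: lquot_fun_def lquot_Un fun_eq_iff restrict_def)
  have "final (ts (dfa L)) = {F \<in> lquot_fun L ` {U. finite U}.
      \<not> (\<forall>X\<in>LQ L. F X \<subseteq> lquot_fun L (- L) X)}"
    by (simp add: ts_def carrier_TS [OF fin] language_dfa lang_trans_dfa [OF fin] jsl_le_def
        subset_Un_eq [symmetric])
  also have "\<dots> = {lquot_fun L U |U. finite U \<and> \<not> (\<forall>X\<in>LQ L. lquot_fun L U X \<subseteq> lquot_fun L (- L) X)}"
    by blast
  finally show "final (ts (dfa L)) = {lquot_fun L U |U. finite U \<and> U \<inter> L \<noteq> {}}"
    by (simp only: le_iff)
qed

lemma lang_dfa_syn:
  assumes fin: "finite (LQ L)"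
  shows "lang_dfa (Syn L) (synt_class L) (syn L) L"
proof -
  interpret lang_semiring "Syn L" "synt_class L"
    by (rule lang_semiring_Syn)
  show ?thesis
  proof
    \<comment> \<open>Finiteness of \<open>Syn L\<close> comes from embedding it by
      \<open>alpha L\<close> into the finite set of quotient functions.\<close>
    have "alpha L ` carrier (Syn L) \<subseteq> range (lquot_fun L)"
      by (auto simp: carrier alpha_synt_class)
    moreover have "inj_on (alpha L) (carrier (Syn L))"
      by (auto simp: inj_on_def carrier alpha_synt_class synt_class_eq_iff)
    ultimately show "finite (carrier (Syn L))"
      using finite_lquot_funs [OF fin] by (metis finite_imageD finite_subset)
    \<comment> \<open>Equality of classes is equality of quotient functions, so a finite substitute
      for \<open>- L\<close> again gives the largest non-final state.\<close>
    obtain T where T: "finite T" "lquot_fun L T = lquot_fun L (- L)"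
      using lquot_fun_finite_language [OF fin] by blast
    show "\<exists>T. finite T \<and> (\<forall>U. finite U \<longrightarrow>
        (synt_class L (U \<union> T) = synt_class L T \<longleftrightarrow> U \<inter> L = {}))"
      using T lquot_fun_nonfinal_iff [OF T(2)]
      by (intro exI [of _ T]) (simp add: synt_class_eq_iff)
  qed (simp_all add: syn_def mult)
qed

theorem theorem3p7p6:
  fixes L :: "'a lang"
  assumes "regular L"
  shows "lquot_fun L respects synt_cong L
    \<and> (\<forall>U. finite U \<longrightarrow> alpha L (synt_class L U) = (\<lambda>X\<in>LQ L. lquot U X))
    \<and> alpha L \<in> idem_semiring_iso (Syn L) (TS (dfa L))
    \<and> alpha L \<in> jsl_dfa_iso (syn L) (ts (dfa L))"
proof (intro conjI)
  note fin = finite_LQ [OF assms]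
  show "lquot_fun L respects synt_cong L"
    by (auto simp: congruent_def synt_cong_iff)
  show "\<forall>U. finite U \<longrightarrow> alpha L (synt_class L U) = (\<lambda>X\<in>LQ L. lquot U X)"
    by (simp add: alpha_synt_class lquot_fun_def)
  show "alpha L \<in> idem_semiring_iso (Syn L) (TS (dfa L))"
    using lang_semiring_Syn lang_semiring_TS [OF fin] synt_class_eq_iff alpha_synt_class
    by (rule lang_semiring_iso)
  show "alpha L \<in> jsl_dfa_iso (syn L) (ts (dfa L))"
    using lang_dfa_syn [OF fin] lang_dfa_ts [OF fin] synt_class_eq_iff alpha_synt_class
    by (rule lang_dfa_iso)
qed

end
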